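(* Let $b$ be a graph over $(X,m)$ and $p\in(1,\infty)$. Assume that $w=\Delta_pu/u^{p-1}$ is a $p$-critical Hardy weight with Agmon ground state $u$. If for some finite $K\subseteq X$ and some $\tilde w\colon X\to[0,\infty)$ we have $$\mathcal E_p(\varphi)\ge(w+\tilde w)_p(\varphi)\qquad\text{for all }\varphi\in C_c(X\setminus K),$$ then $u\in\ell^p(X,\tilde wm)$, i.e. $\sum_{x\in X}\tilde w(x)u(x)^pm(x)<\infty$. In particular, if $w$ is $p$-null-critical, then it is $p$-optimal at infinity.
   Context: $X$ is a countable set and $m\colon X\to(0,\infty)$. A graph over $(X,m)$ is a symmetric function $b\colon X\times X\to[0,\infty)$ vanishing on the diagonal with $\sum_{y}b(x,y)<\infty$ for all $x\in X$ (local finiteness is not assumed); graphs are assumed connected: any $x,y\in X$ are joined by $x=x_0,\dots,x_n=y$ with $b(x_{i-1},x_i)>0$. $C(X)$ denotes the real functions on $X$ and $C_c(X)$ those of finite support; $C_c(X\setminus K)$ is the set of $\varphi\in C_c(X)$ vanishing on $K$. Put $t^{\langle p-1\rangle}=|t|^{p-1}\operatorname{sgn}(t)$. $\mathcal F_p=\{f\in C(X):\sum_yb(x,y)|f(x)-f(y)|^{p-1}<\infty\ \forall x\in X\}$; the $p$-Laplacian is $\Delta_pf(x)=\frac1{m(x)}\sum_yb(x,y)(f(x)-f(y))^{\langle p-1\rangle}$ for $f\in\mathcal F_p$; the $p$-energy is $\mathcal E_p(\varphi)=\frac12\sum_{x,y}b(x,y)|\varphi(x)-\varphi(y)|^p$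 for $\varphi\in C_c(X)$; and $v_p(\varphi)=\sum_xv(x)|\varphi(x)|^pm(x)$ for $v\in C(X)$. $w\in C(X)$ is a Hardy-type weight if $\mathcal E_p(\varphi)\ge w_p(\varphi)$ for all $\varphi\in C_c(X)$, and a Hardy weight if moreover $w>0$ on $X$. A Hardy-type weight $w$ is $p$-critical if there is no Hardy-type weight $\tilde w$ with $\tilde w\ge w$, $\tilde w\neq w$. This is equivalent to the existence of an Agmon ground state: a positive $u\in\mathcal F_p$, unique up to positive multiples, with $\Delta_pu\ge wu^{p-1}$ (then in fact $\Delta_pu=wu^{p-1}$). A $p$-critical $w$ is $p$-null-critical if its Agmon ground state $u$ is not in $\ell^p(X,|w|m)$. A Hardy weight $w$ is $p$-optimal at infinity if, for real $\lambda$, the validity of $\mathcal E_p(\varphi)\ge(1+\lambda)w_p(\varphi)$ for all $\varphi\in C_c(X\setminus K)$ for some finite $K\subseteq X$ implies $\lambda\le0$. *)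

theory Defs
  imports "HOL-Analysis.Analysis" "HOL-Library.Countable"
begin

text \<open>The countable vertex set \<open>X\<close> is the whole type \<open>'a :: countable\<close>.  Exponents are real, so
  powers are written with \<^const>\<open>powr\<close>; for \<open>p > 1\<close> the convention \<open>0 powr (p - 1) = 0\<close> is the
  intended one.\<close>

locale weighted_graph =
  fixes b :: "'a::countable \<Rightarrow> 'a \<Rightarrow> real" and m :: "'a \<Rightarrow> real"
  assumes m_pos: "m x > 0"
    and b_nonneg: "b x y \<ge> 0"
    and b_sym: "b x y = b y x"
    and b_diag: "b x x = 0"
    and b_summable: "(\<lambda>y. b x y) summable_on UNIV"
    and b_connected: "(x, y) \<in> {(x, y). b x y > 0}\<^sup>*"

definition Cc :: "'a set \<Rightarrow> ('a \<Rightarrow> real) set" where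
  "Cc A = {\<phi>. finite {x. \<phi> x \<noteq> 0} \<and> (\<forall>x. x \<notin> A \<longrightarrow> \<phi> x = 0)}"

definition signed_power :: "real \<Rightarrow> real \<Rightarrow> real" where
  "signed_power t q = \<bar>t\<bar> powr q * sgn t"

definition Fp :: "('a \<Rightarrow> 'a \<Rightarrow> real) \<Rightarrow> real \<Rightarrow> ('a \<Rightarrow> real) set" where
  "Fp b p = {f. \<forall>x. (\<lambda>y. b x y * \<bar>f x - f y\<bar> powr (p - 1)) summable_on UNIV}"

text \<open>Meaningful for \<open>f \<in> Fp b p\<close>, where the series converges absolutely.\<close>

definition p_laplacian ::
  "('a \<Rightarrow> 'a \<Rightarrow> real) \<Rightarrow> ('a \<Rightarrow> real) \<Rightarrow> real \<Rightarrow> ('a \<Rightarrow> real) \<Rightarrow> 'a \<Rightarrow> real" where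
  "p_laplacian b m p f x = 1 / m x * (\<Sum>\<^sub>\<infinity>y. b x y * signed_power (f x - f y) (p - 1))"

text \<open>Only used for finitely supported \<open>\<phi>\<close>, for which the double series converges on every
  weighted graph.\<close>

definition p_energy :: "('a \<Rightarrow> 'a \<Rightarrow> real) \<Rightarrow> real \<Rightarrow> ('a \<Rightarrow> real) \<Rightarrow> real" where
  "p_energy b p \<phi> = 1/2 * (\<Sum>\<^sub>\<infinity>(x, y). b x y * \<bar>\<phi> x - \<phi> y\<bar> powr p)"

definition p_form :: "('a \<Rightarrow> real) \<Rightarrow> real \<Rightarrow> ('a \<Rightarrow> real) \<Rightarrow> ('a \<Rightarrow> real) \<Rightarrow> real" where
  "p_form m p v \<phi> = (\<Sum>\<^sub>\<infinity>x. v x * \<bar>\<phi> x\<bar> powr p * m x)"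

definition lp_space :: "real \<Rightarrow> ('a \<Rightarrow> real) \<Rightarrow> ('a \<Rightarrow> real) set" where
  "lp_space p \<mu> = {f. (\<lambda>x. \<bar>f x\<bar> powr p * \<mu> x) summable_on UNIV}"

definition hardy_type_weight ::
  "('a \<Rightarrow> 'a \<Rightarrow> real) \<Rightarrow> ('a \<Rightarrow> real) \<Rightarrow> real \<Rightarrow> ('a \<Rightarrow> real) \<Rightarrow> bool" where
  "hardy_type_weight b m p w \<longleftrightarrow> (\<forall>\<phi>\<in>Cc UNIV. p_energy b p \<phi> \<ge> p_form m p w \<phi>)"

definition hardy_weight ::
  "('a \<Rightarrow> 'a \<Rightarrow> real) \<Rightarrow> ('a \<Rightarrow> real) \<Rightarrow> real \<Rightarrow> ('a \<Rightarrow> real) \<Rightarrow> bool" where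
  "hardy_weight b m p w \<longleftrightarrow> hardy_type_weight b m p w \<and> (\<forall>x. w x > 0)"

definition p_critical ::
  "('a \<Rightarrow> 'a \<Rightarrow> real) \<Rightarrow> ('a \<Rightarrow> real) \<Rightarrow> real \<Rightarrow> ('a \<Rightarrow> real) \<Rightarrow> bool" where
  "p_critical b m p w \<longleftrightarrow> hardy_type_weight b m p w \<and>
     \<not> (\<exists>w'. hardy_type_weight b m p w' \<and> (\<forall>x. w' x \<ge> w x) \<and> w' \<noteq> w)"

definition positive_supersolution ::
  "('a \<Rightarrow> 'a \<Rightarrow> real) \<Rightarrow> ('a \<Rightarrow> real) \<Rightarrow> real \<Rightarrow> ('a \<Rightarrow> real) \<Rightarrow> ('a \<Rightarrow> real) \<Rightarrow> bool" where
  "positive_supersolution b m p w u \<longleftrightarrow> u \<in> Fp b p \<and> (\<forall>x. u x > 0) \<and>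
     (\<forall>x. p_laplacian b m p u x \<ge> w x * u x powr (p - 1))"

definition agmon_ground_state ::
  "('a \<Rightarrow> 'a \<Rightarrow> real) \<Rightarrow> ('a \<Rightarrow> real) \<Rightarrow> real \<Rightarrow> ('a \<Rightarrow> real) \<Rightarrow> ('a \<Rightarrow> real) \<Rightarrow> bool" where
  "agmon_ground_state b m p w u \<longleftrightarrow> positive_supersolution b m p w u \<and>
     (\<forall>u'. positive_supersolution b m p w u' \<longrightarrow> (\<exists>c>0. \<forall>x. u' x = c * u x))"

text \<open>Agmon ground states are unique up to positive multiples, so it does not matter which one
  is tested below.\<close>

definition p_null_critical ::
  "('a \<Rightarrow> 'a \<Rightarrow> real) \<Rightarrow> ('a \<Rightarrow> real) \<Rightarrow> real \<Rightarrow> ('a \<Rightarrow> real) \<Rightarrow> bool" where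
  "p_null_critical b m p w \<longleftrightarrow> p_critical b m p w \<and>
     (\<exists>u. agmon_ground_state b m p w u \<and> u \<notin> lp_space p (\<lambda>x. \<bar>w x\<bar> * m x))"

definition p_optimal_at_infinity ::
  "('a \<Rightarrow> 'a \<Rightarrow> real) \<Rightarrow> ('a \<Rightarrow> real) \<Rightarrow> real \<Rightarrow> ('a \<Rightarrow> real) \<Rightarrow> bool" where
  "p_optimal_at_infinity b m p w \<longleftrightarrow> hardy_weight b m p w \<and>
     (\<forall>l::real. (\<exists>K. finite K \<and>
         (\<forall>\<phi>\<in>Cc (- K). p_energy b p \<phi> \<ge> (1 + l) * p_form m p w \<phi>)) \<longrightarrow> l \<le> 0)"

end

theory Submission
  imports Defs
begin

text \<open>
  Write \<open>h(\<phi>) = E(\<phi>) - w(\<phi>)\<close> for the difference of the \<open>p\<close>-energy and the weight form, the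
  constant \<open>deficit\<close> below. If the
  positive function \<open>u\<close> solves \<open>\<Delta>u = w u\<^sup>p\<^sup>-\<^sup>1\<close>, then summing by parts turns \<open>h\<close> into a sum over edges,
  \<open>2 h(\<phi>) = \<Sum> b(x,y) gap(x,y)\<close>, where the gap is the difference of the two sides in the discrete
  Picone inequality for \<open>\<phi>\<close> and \<open>u\<close> (lemma \<open>Picone_identity\<close>). Everything about \<open>h\<close> then
  follows from properties of the gap, which is a function of four real numbers:
  it is nonnegative, it vanishes on nonnegative \<open>\<phi>\<close> only if \<open>\<phi>/u\<close> takes the same value at both
  ends of the edge, and it does not increase when \<open>\<phi>\<close> is replaced by \<open>min |\<phi>| u\<close>
  (lemmas \<open>picone_gap_nonneg\<close>, \<open>picone_gap_pos\<close>, \<open>picone_gap_truncate\<close>).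

  Criticality says that \<open>w\<close> cannot be increased at a single vertex \<open>z\<close>. It therefore provides
  test functions with \<open>\<phi>(z) = u(z)\<close> and \<open>h(\<phi>)\<close> arbitrarily small; by truncation they may be
  taken between \<open>0\<close> and \<open>u\<close>. Small \<open>h\<close> forces a small gap on every edge, so along paths
  starting at \<open>z\<close> the quotient \<open>\<phi>/u\<close> tends to \<open>1\<close>. In this way \<open>u\<close> is the pointwise limit of
  test functions \<open>0 \<le> \<phi>\<^sub>n \<le> u\<close> with bounded \<open>h(\<phi>\<^sub>n)\<close> (lemma \<open>null_sequence\<close>).

  Setting \<open>\<phi>\<^sub>n\<close> to zero on a finite set \<open>K\<close> raises \<open>h\<close> by at most a constant independent of \<open>n\<close>
  (lemma \<open>deficit_cutoff_bound\<close>); for graphs that are not locally finite this rests on \<open>u \<in> F\<^sub>p\<close>.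
  The cut-off functions are admissible in the Hardy inequality outside \<open>K\<close>, whence
  \<open>w'(\<phi>\<^sub>n 1\<^bsub>X - K\<^esub>) \<le> h(\<phi>\<^sub>n 1\<^bsub>X - K\<^esub>)\<close> stays bounded, and letting \<open>n\<close> tend to infinity on finite sets
  of vertices gives \<open>u \<in> \<ell>\<^sup>p(w' m)\<close> (lemma \<open>ground_state_in_lp\<close>). Optimality at infinity is the case
  \<open>w' = \<lambda> w\<close> with \<open>\<lambda> > 0\<close>.
\<close>

section \<open>Convexity of powers\<close>

text \<open>Strictness is what later forces \<open>\<phi>/u\<close> to be constant where the Picone gap vanishes.\<close>

lemma powr_gt_tangent:
  fixes p r t :: real
  assumes "p > 1" "r \<ge> 0" "t \<ge> 0" "r \<noteq> t"
  shows "r powr p > t powr p + p * t powr (p - 1) * (r - t)"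
proof -
  have cont: "continuous_on {x..y} (\<lambda>z. z powr p)" if "x \<ge> 0" for x y :: real
    using that assms(1) by (intro continuous_on_powr' continuous_intros) auto
  have der: "((\<lambda>z. z powr p) has_real_derivative p * z powr (p - 1)) (at z)" if "z > 0" for z :: real
    using that by (rule has_real_derivative_powr)
  have mvt: "\<exists>z. x < z \<and> z < y \<and> y powr p - x powr p = (y - x) * (p * z powr (p - 1))"
    if x: "x \<ge> 0" and xy: "x < y" for x y :: real
  proof -
    obtain l z where z: "x < z" "z < y" "DERIV (\<lambda>z. z powr p) z :> l"
      "y powr p - x powr p = (y - x) * l"
      using MVT[OF xy cont[OF x]] der x
      by (metis order.strict_trans1 real_differentiable_def)
    then have "l = p * z powr (p - 1)"
      using DERIV_unique der x by (meson le_less_trans)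
    then show ?thesis using z by blast
  qed
  show ?thesis
  proof (cases "t < r")
    case True
    then obtain z where z: "t < z" "r powr p - t powr p = (r - t) * (p * z powr (p - 1))"
      using mvt[OF assms(3)] by blast
    have "t powr (p - 1) < z powr (p - 1)"
      using z(1) assms by (intro powr_less_mono2) auto
    then have "(r - t) * (p * t powr (p - 1)) < (r - t) * (p * z powr (p - 1))"
      using True assms(1) by simp
    then show ?thesis using z(2) by (simp add: algebra_simps)
  next
    case False
    then have "r < t" using assms by simp
    then obtain z where z: "r < z" "z < t" "t powr p - r powr p = (t - r) * (p * z powr (p - 1))"
      using mvt[OF assms(2)] by blast
    have "z powr (p - 1) < t powr (p - 1)"
      using z assms by (intro powr_less_mono2) auto
    then have "(t - r) * (p * z powr (p - 1)) < (t - r) * (p * t powr (p - 1))"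
      using \<open>r < t\<close> assms(1) by simp
    then show ?thesis using z(3) by (simp add: algebra_simps)
  qed
qed

lemma abs_powr_ge_tangent:
  fixes p r t :: real
  assumes "p > 1"
  shows "\<bar>r\<bar> powr p \<ge> \<bar>t\<bar> powr p + p * signed_power t (p - 1) * (r - t)"
proof -
  have nonneg: "\<bar>r\<bar> powr p \<ge> t powr p + p * t powr (p - 1) * (r - t)" if "t \<ge> 0" for r t :: real
  proof -
    have "t powr p + p * t powr (p - 1) * (r - t) \<le> t powr p + p * t powr (p - 1) * (\<bar>r\<bar> - t)"
      using assms by (intro add_left_mono mult_left_mono) auto
    also have "\<dots> \<le> \<bar>r\<bar> powr p"
      using powr_gt_tangent[of p "\<bar>r\<bar>" t] that assms by (cases "\<bar>r\<bar> = t") auto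
    finally show ?thesis .
  qed
  show ?thesis
  proof (cases "t \<ge> 0")
    case True
    then show ?thesis using nonneg[of t r] by (cases "t = 0") (auto simp: signed_power_def)
  next
    case False
    then show ?thesis using nonneg[of "- t" "- r"] by (auto simp: signed_power_def algebra_simps)
  qed
qed

text \<open>By convexity, increments of \<open>|.|\<^sup>p\<close> over an interval of length \<open>d\<close> grow when the interval is
  moved to the right: \<open>z + d\<close> and \<open>z + e\<close> are complementary convex combinations of the end points
  \<open>z\<close> and \<open>z + e + d\<close>.\<close>

lemma abs_powr_diff_mono:
  fixes p z d e :: real
  assumes "p > 1" "d \<ge> 0" "e \<ge> 0"
  shows "\<bar>z + d\<bar> powr p - \<bar>z\<bar> powr p \<le> \<bar>z + e + d\<bar> powr p - \<bar>z + e\<bar> powr p"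
proof (cases "d + e = 0")
  case False
  then have pos: "d + e > 0" using assms by simp
  define f where "f r = \<bar>r\<bar> powr p" for r :: real
  have jensen: "(d + e) * f (z + q) \<le> (d + e - q) * f z + q * f (z + e + d)"
    if "0 \<le> q" "q \<le> d + e" for q
  proof -
    define g where "g = p * signed_power (z + q) (p - 1)"
    have "f z \<ge> f (z + q) + g * (- q)" "f (z + e + d) \<ge> f (z + q) + g * (d + e - q)"
      using abs_powr_ge_tangent[OF assms(1), of "z + q" z]
        abs_powr_ge_tangent[OF assms(1), of "z + q" "z + e + d"]
      by (auto simp: f_def g_def algebra_simps)
    then have "(d + e - q) * f z + q * f (z + e + d)
        \<ge> (d + e - q) * (f (z + q) + g * (- q)) + q * (f (z + q) + g * (d + e - q))"
      using that by (intro add_mono mult_left_mono) auto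
    then show ?thesis by (simp add: algebra_simps)
  qed
  have "(d + e) * (f (z + d) + f (z + e)) \<le> (d + e) * (f z + f (z + e + d))"
    using jensen[of d] jensen[of e] assms by (simp add: algebra_simps)
  then have "f (z + d) + f (z + e) \<le> f z + f (z + e + d)"
    using pos by simp
  then show ?thesis by (simp add: f_def)
qed (use assms in \<open>auto simp: add_nonneg_eq_0_iff\<close>)

section \<open>The gap in Picone's inequality\<close>

text \<open>For an edge with values \<open>a, c\<close> of the positive function \<open>u\<close> and \<open>A, C\<close> of the test function:
  the energy of the edge minus its share in the weak formulation of \<open>\<Delta>u\<close> tested with
  \<open>|\<phi>|\<^sup>p / u\<^sup>p\<^sup>-\<^sup>1\<close>. For \<open>p = 2\<close> it equals \<open>a c (A/a - C/c)\<^sup>2\<close>.\<close>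

definition picone_gap :: "real \<Rightarrow> real \<Rightarrow> real \<Rightarrow> real \<Rightarrow> real \<Rightarrow> real" where
  "picone_gap p a c A C = \<bar>A - C\<bar> powr p
     - signed_power (a - c) (p - 1) * (\<bar>A\<bar> powr p / a powr (p - 1) - \<bar>C\<bar> powr p / c powr (p - 1))"

lemma picone_gap_swap: "picone_gap p a c A C = picone_gap p c a C A"
proof -
  have "signed_power (a - c) (p - 1) = - signed_power (c - a) (p - 1)"
    by (simp add: signed_power_def abs_minus_commute sgn_if)
  then show ?thesis
    by (simp add: picone_gap_def abs_minus_commute algebra_simps)
qed

lemma picone_gap_self:
  assumes "p > 1" "a > 0" "c > 0"
  shows "picone_gap p a c a c = 0"
proof -
  have q: "x powr p = x * x powr (p - 1)" if "x \<ge> 0" for x :: real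
    using powr_mult_base[OF that, of "p - 1"] by simp
  show ?thesis
    using assms q[of a] q[of c] q[of "\<bar>a - c\<bar>"]
    by (auto simp: picone_gap_def signed_power_def sgn_if abs_if algebra_simps)
qed

text \<open>In terms of the quotients \<open>s = A/a\<close> and \<open>t = C/c\<close> the subtracted term is
  \<open>(a - c)\<^sup>p\<^sup>-\<^sup>1 (a s\<^sup>p - c t\<^sup>p)\<close>. If \<open>A > C\<close>, then \<open>s\<close> is the mean of \<open>r = (A - C)/(a - c)\<close> and \<open>t\<close>
  with weights \<open>(a - c)/a\<close> and \<open>c/a\<close>, and strict convexity of the power gives the claim.\<close>

lemma picone_gap_pos_aux:
  assumes p: "p > 1" and "c > 0" "a > c" "A \<ge> 0" "C \<ge> 0" and neq: "A / a \<noteq> C / c"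
  shows "picone_gap p a c A C > 0"
proof -
  define s t where "s = A / a" and "t = C / c"
  have AC: "A = a * s" "C = c * t" and st: "s \<ge> 0" "t \<ge> 0" "s \<noteq> t"
    using assms by (auto simp: s_def t_def)
  have q: "x powr p = x * x powr (p - 1)" if "x \<ge> 0" for x :: real
    using powr_mult_base[OF that, of "p - 1"] by simp
  have hom: "\<bar>x * y\<bar> powr p / x powr (p - 1) = x * y powr p" if "x > 0" "y \<ge> 0" for x y
    using that q[of x] by (simp add: abs_mult powr_mult)
  have gap: "picone_gap p a c A C
      = \<bar>A - C\<bar> powr p - (a - c) powr (p - 1) * (a * s powr p - c * t powr p)"
    using assms st hom[of a s] hom[of c t] by (simp add: picone_gap_def signed_power_def AC)
  show ?thesis
  proof (cases "A > C")
    case False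
    \<comment> \<open>Here \<open>s \<le> (c / a) t < t\<close>, so the subtracted term is negative.\<close>
    have "a * s \<le> c * t" using False AC by simp
    have "s < t"
    proof (rule ccontr)
      assume "\<not> s < t"
      then have "t < s" using st by simp
      have "c * t \<le> c * s" using \<open>t < s\<close> assms by simp
      also have "c * s < a * s" using \<open>t < s\<close> st assms by simp
      finally show False using \<open>a * s \<le> c * t\<close> by simp
    qed
    have "a * s powr p = (a * s) * s powr (p - 1)" using q st by simp
    also have "\<dots> \<le> (c * t) * s powr (p - 1)"
      using \<open>a * s \<le> c * t\<close> by (intro mult_right_mono) auto
    also have "\<dots> < (c * t) * t powr (p - 1)"
      using \<open>s < t\<close> st assms by (intro mult_strict_left_mono powr_less_mono2 mult_pos_pos) auto
    also have "\<dots> = c * t powr p" using q[of t] st by simp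
    finally have "(a - c) powr (p - 1) * (a * s powr p - c * t powr p) < 0"
      using assms by (intro mult_pos_neg) auto
    moreover have "\<bar>A - C\<bar> powr p \<ge> 0" by simp
    ultimately show ?thesis unfolding gap by linarith
  next
    case True
    define r where "r = (A - C) / (a - c)"
    have r: "r \<ge> 0" "(a - c) * r = A - C" using True assms by (auto simp: r_def)
    have "r powr p \<ge> s powr p + p * s powr (p - 1) * (r - s)"
      using powr_gt_tangent[of p r s] p r st by (cases "r = s") auto
    moreover have "t powr p > s powr p + p * s powr (p - 1) * (t - s)"
      using powr_gt_tangent[of p t s] p st by auto
    ultimately have "(a - c) * r powr p + c * t powr p
        > (a - c) * (s powr p + p * s powr (p - 1) * (r - s))
          + c * (s powr p + p * s powr (p - 1) * (t - s))"
      using assms by (intro add_le_less_mono mult_left_mono mult_strict_left_mono) auto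
    also have "(a - c) * (s powr p + p * s powr (p - 1) * (r - s))
          + c * (s powr p + p * s powr (p - 1) * (t - s))
        = a * s powr p + p * s powr (p - 1) * ((a - c) * r + c * t - a * s)"
      by (simp add: algebra_simps)
    also have "\<dots> = a * s powr p" using r AC by simp
    finally have "a * s powr p - c * t powr p < (a - c) * r powr p" by simp
    then have "(a - c) powr (p - 1) * (a * s powr p - c * t powr p)
        < (a - c) powr (p - 1) * ((a - c) * r powr p)"
      using assms by (intro mult_strict_left_mono) auto
    also have "\<dots> = (a - c) powr p * r powr p"
      using q[of "a - c"] assms by simp
    also have "\<dots> = \<bar>A - C\<bar> powr p"
      using powr_mult[of "a - c" r p] r assms True by simp
    finally show ?thesis unfolding gap by simp
  qed
qed

lemma picone_gap_pos:
  assumes "p > 1" "a > 0" "c > 0" "A \<ge> 0" "C \<ge> 0" "A / a \<noteq> C / c"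
  shows "picone_gap p a c A C > 0"
proof -
  consider "a > c" | "c > a" | "a = c" by linarith
  then show ?thesis
  proof cases
    case 1 then show ?thesis using picone_gap_pos_aux assms by simp
  next
    case 2 then show ?thesis
      using picone_gap_pos_aux[of p a c C A] assms by (subst picone_gap_swap) auto
  next
    case 3 then show ?thesis using assms by (auto simp: picone_gap_def signed_power_def)
  qed
qed

lemma picone_gap_abs:
  assumes "p > 1"
  shows "picone_gap p a c \<bar>A\<bar> \<bar>C\<bar> \<le> picone_gap p a c A C"
  using assms by (auto simp: picone_gap_def intro!: powr_mono2)

text \<open>Where the two quotients agree, the gap is a multiple of that of \<open>u\<close> itself, which is zero.\<close>

lemma picone_gap_nonneg:
  assumes "p > 1" "a > 0" "c > 0"
  shows "picone_gap p a c A C \<ge> 0"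
proof -
  have "picone_gap p a c \<bar>A\<bar> \<bar>C\<bar> \<ge> 0"
  proof (cases "\<bar>A\<bar> / a = \<bar>C\<bar> / c")
    case True
    define s where "s = \<bar>A\<bar> / a"
    have s: "s \<ge> 0" "\<bar>A\<bar> = s * a" "\<bar>C\<bar> = s * c"
      using True assms by (auto simp: s_def field_simps)
    have "picone_gap p a c \<bar>A\<bar> \<bar>C\<bar> = s powr p * picone_gap p a c a c"
    proof -
      have "\<bar>s * a - s * c\<bar> powr p = s powr p * \<bar>a - c\<bar> powr p"
        using s(1) by (simp add: powr_mult abs_mult flip: right_diff_distrib)
      then show ?thesis
        using assms s(1) unfolding s(2,3) picone_gap_def
        by (simp add: abs_mult powr_mult algebra_simps)
    qed
    then show ?thesis using picone_gap_self assms by simp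
  next
    case False
    then show ?thesis using picone_gap_pos[of p a c "\<bar>A\<bar>" "\<bar>C\<bar>"] assms by simp
  qed
  then show ?thesis using picone_gap_abs[OF assms(1)] order_trans by blast
qed

text \<open>If both ends are truncated, the new gap is that of \<open>u\<close>, the minimal value zero. If only one is,
  say \<open>A > a\<close> and \<open>C \<le> c\<close>, the increment of the energy from \<open>a\<close> to \<open>A\<close> is at
  least the one obtained with \<open>c\<close> in place of \<open>C\<close>, and for \<open>C = c\<close> the smaller gap is zero.\<close>

lemma picone_gap_truncate:
  assumes p: "p > 1" and a: "a > 0" and c: "c > 0"
  shows "picone_gap p a c (min \<bar>A\<bar> a) (min \<bar>C\<bar> c) \<le> picone_gap p a c A C"
proof -
  have one_sided: "picone_gap p a c a C \<le> picone_gap p a c A C"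
    if "A \<ge> a" "0 \<le> C" "C \<le> c" "a > 0" "c > 0" for a c A C
  proof -
    have "\<bar>A - c\<bar> powr p - \<bar>a - c\<bar> powr p \<le> \<bar>A - C\<bar> powr p - \<bar>a - C\<bar> powr p"
      using abs_powr_diff_mono[OF p, of "A - a" "c - C" "a - c"] that by simp
    moreover have "picone_gap p a c a c \<le> picone_gap p a c A c"
      using picone_gap_self picone_gap_nonneg p that by simp
    ultimately show ?thesis
      by (simp add: picone_gap_def algebra_simps)
  qed
  have "picone_gap p a c (min \<bar>A\<bar> a) (min \<bar>C\<bar> c) \<le> picone_gap p a c \<bar>A\<bar> \<bar>C\<bar>"
  proof (cases "\<bar>A\<bar> \<le> a"; cases "\<bar>C\<bar> \<le> c")
    assume "\<bar>A\<bar> \<le> a" "\<not> \<bar>C\<bar> \<le> c"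
    then show ?thesis
      using one_sided[of c "\<bar>C\<bar>" "\<bar>A\<bar>" a] a c
      by (simp add: picone_gap_swap[of p c a])
  next
    assume "\<not> \<bar>A\<bar> \<le> a" "\<bar>C\<bar> \<le> c"
    then show ?thesis using one_sided[of a "\<bar>A\<bar>" "\<bar>C\<bar>" c] a c by simp
  next
    assume "\<not> \<bar>A\<bar> \<le> a" "\<not> \<bar>C\<bar> \<le> c"
    then show ?thesis using picone_gap_self picone_gap_nonneg p a c by simp
  qed simp
  then show ?thesis using picone_gap_abs[OF p] order_trans by blast
qed

text \<open>Compactness of \<open>[0, c]\<close>: any limit point \<open>l\<close> of \<open>C\<close> has gap zero against the limit \<open>a\<close> of \<open>A\<close>,
  so \<open>l / c = a / a = 1\<close>.\<close>

lemma picone_gap_stability: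
  fixes A C :: "nat \<Rightarrow> real"
  assumes p: "p > 1" and a: "a > 0" and c: "c > 0"
    and A: "A \<longlonglongrightarrow> a" and C: "\<And>n. 0 \<le> C n" "\<And>n. C n \<le> c"
    and gap: "(\<lambda>n. picone_gap p a c (A n) (C n)) \<longlonglongrightarrow> 0"
  shows "C \<longlonglongrightarrow> c"
proof (rule ccontr)
  assume "\<not> C \<longlonglongrightarrow> c"
  then obtain e where e: "e > 0" "\<not> (\<forall>\<^sub>F n in sequentially. dist (C n) c < e)"
    by (auto simp: tendsto_iff)
  have "infinite {n. C n \<le> c - e}"
  proof
    assume "finite {n. C n \<le> c - e}"
    then have "\<forall>\<^sub>F n in sequentially. \<not> C n \<le> c - e"
      unfolding cofinite_eq_sequentially[symmetric] eventually_cofinite by simp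
    then have "\<forall>\<^sub>F n in sequentially. dist (C n) c < e"
      by eventually_elim (use C(2) e(1) in \<open>smt (verit) dist_real_def\<close>)
    then show False using e by blast
  qed
  then obtain r :: "nat \<Rightarrow> nat" where r: "strict_mono r" "\<And>n. C (r n) \<le> c - e"
    using infinite_enumerate by (metis mem_Collect_eq)
  have "\<forall>n. (C \<circ> r) n \<in> {0..c - e}" using C r by auto
  then obtain l s where l: "l \<in> {0..c - e}" "strict_mono s" "((C \<circ> r) \<circ> s) \<longlonglongrightarrow> l"
    using compact_Icc[of 0 "c - e"] unfolding compact_def by metis
  have sub: "strict_mono (r \<circ> s)" using r l strict_mono_o by blast
  have A': "(A \<circ> (r \<circ> s)) \<longlonglongrightarrow> a" using LIMSEQ_subseq_LIMSEQ[OF A sub] .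
  have "(\<lambda>n. picone_gap p a c ((A \<circ> (r \<circ> s)) n) ((C \<circ> r \<circ> s) n)) \<longlonglongrightarrow> picone_gap p a c a l"
    unfolding picone_gap_def using p a c
    by (intro tendsto_intros A' l) auto
  moreover have "(\<lambda>n. picone_gap p a c ((A \<circ> (r \<circ> s)) n) ((C \<circ> r \<circ> s) n)) \<longlonglongrightarrow> 0"
    using LIMSEQ_subseq_LIMSEQ[OF gap sub] by (simp add: o_def)
  ultimately have "picone_gap p a c a l = 0" by (rule LIMSEQ_unique)
  moreover have "picone_gap p a c a l > 0"
    using picone_gap_pos[of p a c a l] p a c l e by auto
  ultimately show False by simp
qed

section \<open>Double sums and finitely supported functions\<close>

text \<open>Energies and weak formulations are double series over all pairs of vertices, and the graph need
  not be locally finite. The functions involved have finite support, so such a series reduces to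
  finitely many summable rows and, by symmetry, columns.\<close>

lemma has_sum_finite_rows:
  fixes k :: "'a \<Rightarrow> 'b \<Rightarrow> real"
  assumes "finite A" "\<And>x. x \<in> A \<Longrightarrow> k x summable_on UNIV" "\<And>x y. x \<notin> A \<Longrightarrow> k x y = 0"
  shows "((\<lambda>(x, y). k x y) has_sum (\<Sum>x\<in>A. \<Sum>\<^sub>\<infinity>y. k x y)) UNIV"
proof -
  have rows: "k x summable_on UNIV" for x
  proof (cases "x \<in> A")
    case False
    then have "k x = (\<lambda>_. 0)" using assms(3) by blast
    then show ?thesis by simp
  qed (rule assms(2))
  then have rows_abs: "(\<lambda>y. norm (k x y)) summable_on UNIV" for x
    using summable_on_iff_abs_summable_on_real by blast
  have outer: "((\<lambda>x. \<Sum>\<^sub>\<infinity>y. k x y) has_sum (\<Sum>x\<in>A. \<Sum>\<^sub>\<infinity>y. k x y)) UNIV"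
    using assms(1,3) by (intro has_sum_finite_neutralI[of A]) auto
  have "(\<lambda>x. \<Sum>\<^sub>\<infinity>y. norm (k x y)) summable_on UNIV"
    using assms(3)
    by (intro has_sum_imp_summable[OF has_sum_finite_neutralI[OF assms(1) _ _ refl]]) auto
  then have "(\<lambda>z. norm (case z of (x, y) \<Rightarrow> k x y)) summable_on (UNIV \<times> UNIV)"
    using rows_abs by (intro summable_on_SigmaI[OF has_sum_infsum]) auto
  then have "(\<lambda>(x, y). k x y) summable_on (UNIV \<times> UNIV)"
    using summable_on_iff_abs_summable_on_real by blast
  then have "((\<lambda>(x, y). k x y) has_sum (\<Sum>x\<in>A. \<Sum>\<^sub>\<infinity>y. k x y)) (UNIV \<times> UNIV)"
    using rows outer by (intro has_sum_SigmaI) auto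
  then show ?thesis by simp
qed

lemma has_sum_finite_columns:
  fixes k :: "'a \<Rightarrow> 'a \<Rightarrow> real"
  assumes "finite A" "\<And>x. x \<in> A \<Longrightarrow> k x summable_on UNIV" "\<And>x y. x \<notin> A \<Longrightarrow> k x y = 0"
  shows "((\<lambda>(x, y). k y x) has_sum (\<Sum>x\<in>A. \<Sum>\<^sub>\<infinity>y. k x y)) UNIV"
  using has_sum_finite_rows[where k = k, OF assms]
    has_sum_swap[where f = "\<lambda>(x, y). k x y" and A = UNIV and B = UNIV] by simp

lemma finite_support: "\<phi> \<in> Cc A \<Longrightarrow> finite {x. \<phi> x \<noteq> 0}"
  by (simp add: Cc_def)

lemma Cc_finite_support_bounded:
  assumes "\<phi> \<in> Cc A"
  obtains M where "M \<ge> 0" "\<And>x. \<bar>\<phi> x\<bar> \<le> M"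
proof
  define M where "M = (\<Sum>x | \<phi> x \<noteq> 0. \<bar>\<phi> x\<bar>)"
  show "M \<ge> 0" by (auto simp: M_def intro: sum_nonneg)
  show "\<bar>\<phi> x\<bar> \<le> M" for x
    using finite_support[OF assms] \<open>M \<ge> 0\<close>
    by (cases "\<phi> x = 0") (auto simp: M_def intro: member_le_sum)
qed

lemma cutoff_Cc:
  assumes "\<phi> \<in> Cc UNIV"
  shows "(\<lambda>x. if x \<in> K then 0 else \<phi> x) \<in> Cc (- K)"
  using assms by (auto simp: Cc_def elim: rev_finite_subset)

lemma Cc_mono: "A \<subseteq> B \<Longrightarrow> Cc A \<subseteq> Cc B"
  by (auto simp: Cc_def)

lemma p_form_eq_sum:
  assumes "finite A" "{x. \<phi> x \<noteq> 0} \<subseteq> A"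
  shows "p_form m p v \<phi> = (\<Sum>x\<in>A. v x * \<bar>\<phi> x\<bar> powr p * m x)"
  unfolding p_form_def using assms
  by (intro infsumI has_sum_finite_neutralI[of A]) auto

lemma p_form_scale:
  "p_form m p v (\<lambda>x. c * \<phi> x) = \<bar>c\<bar> powr p * p_form m p v \<phi>"
  unfolding p_form_def
  by (simp add: abs_mult powr_mult mult_ac flip: infsum_cmult_right')

lemma p_energy_scale:
  "p_energy b p (\<lambda>x. c * \<phi> x) = \<bar>c\<bar> powr p * p_energy b p \<phi>"
  unfolding p_energy_def
  by (simp add: abs_mult powr_mult mult_ac case_prod_unfold flip: infsum_cmult_right' right_diff_distrib)

section \<open>Energy and Green's formula\<close>

context weighted_graph
begin

lemma energy_summable:
  assumes "\<phi> \<in> Cc UNIV" "p > 0"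
  shows "(\<lambda>(x, y). b x y * \<bar>\<phi> x - \<phi> y\<bar> powr p) summable_on UNIV"
proof -
  obtain M where M: "M \<ge> 0" "\<And>x. \<bar>\<phi> x\<bar> \<le> M" using Cc_finite_support_bounded[OF assms(1)] by blast
  define A where "A = {x. \<phi> x \<noteq> 0}"
  define k where "k x y = (if x \<in> A then b x y * (2 * M) powr p else 0)" for x y
  have fin: "finite A" using finite_support[OF assms(1)] by (simp add: A_def)
  have rows: "k x summable_on UNIV" if "x \<in> A" for x
    unfolding k_def using that summable_on_cmult_left[OF b_summable] by simp
  have zero: "k x y = 0" if "x \<notin> A" for x y using that by (simp add: k_def)
  have "(\<lambda>(x, y). k x y + k y x) summable_on UNIV"
    using summable_on_add[OF has_sum_imp_summable[OF has_sum_finite_rows[where k = k, OF fin rows zero]]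
        has_sum_imp_summable[OF has_sum_finite_columns[where k = k, OF fin rows zero]]]
    by (simp add: case_prod_unfold)
  then show ?thesis
  proof (rule summable_on_comparison_test)
    fix z :: "'a \<times> 'a"
    obtain x y where z: "z = (x, y)" by force
    have "b x y * \<bar>\<phi> x - \<phi> y\<bar> powr p \<le> k x y + k y x"
    proof (cases "x \<in> A \<or> y \<in> A")
      case True
      have "\<bar>\<phi> x - \<phi> y\<bar> \<le> 2 * M" using M(2)[of x] M(2)[of y] by linarith
      then have "b x y * \<bar>\<phi> x - \<phi> y\<bar> powr p \<le> b x y * (2 * M) powr p"
        using assms b_nonneg by (intro mult_left_mono powr_mono2) auto
      also have "\<dots> \<le> k x y + k y x"
        using True b_nonneg b_sym[of x y] by (auto simp: k_def)
      finally show ?thesis .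
    qed (auto simp: A_def k_def)
    then show "(case z of (x, y) \<Rightarrow> b x y * \<bar>\<phi> x - \<phi> y\<bar> powr p) \<le> (case z of (x, y) \<Rightarrow> k x y + k y x)"
      using z by simp
  qed (auto simp: b_nonneg)
qed

lemma energy_has_sum:
  assumes "\<phi> \<in> Cc UNIV" "p > 0"
  shows "((\<lambda>(x, y). b x y * \<bar>\<phi> x - \<phi> y\<bar> powr p) has_sum 2 * p_energy b p \<phi>) UNIV"
  using has_sum_infsum[OF energy_summable[OF assms]] by (simp add: p_energy_def)

text \<open>Since \<open>u(y) \<le> |u(x) - u(y)| + u(x)\<close>, membership in \<open>F\<^sub>p\<close> controls the values of \<open>u\<close> near \<open>x\<close> and
  not only its differences.\<close>

lemma Fp_summable_powr:
  assumes "u \<in> Fp b p" "p > 1" "\<And>x. u x > 0"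
  shows "(\<lambda>y. b x y * u y powr (p - 1)) summable_on UNIV"
proof (rule summable_on_comparison_test)
  let ?g = "\<lambda>y. 2 powr (p - 1) * (b x y * \<bar>u x - u y\<bar> powr (p - 1))
      + b x y * (2 * u x) powr (p - 1)"
  show "?g summable_on UNIV"
    using assms(1) by (intro summable_on_add summable_on_cmult_right summable_on_cmult_left b_summable)
      (auto simp: Fp_def)
  show "b x y * u y powr (p - 1) \<le> ?g y" for y
  proof -
    let ?d = "\<bar>u x - u y\<bar>"
    have "u y \<le> 2 * max ?d (u x)" using assms(3)[of x] by (auto simp: max_def abs_if)
    then have "u y powr (p - 1) \<le> (2 * max ?d (u x)) powr (p - 1)"
      using assms(2) assms(3)[of y] by (intro powr_mono2) auto
    also have "\<dots> \<le> (2 * ?d) powr (p - 1) + (2 * u x) powr (p - 1)"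
      by (cases "?d \<le> u x") (auto simp: max_def)
    finally have "b x y * u y powr (p - 1)
        \<le> b x y * ((2 * ?d) powr (p - 1) + (2 * u x) powr (p - 1))"
      using b_nonneg by (intro mult_left_mono)
    then show ?thesis by (simp add: powr_mult algebra_simps)
  qed
qed (use b_nonneg in auto)

text \<open>The row sums of \<open>b(x,y) (u(x) - u(y))\<^sup>\<langle>\<^sup>p\<^sup>-\<^sup>1\<^sup>\<rangle>\<close> are \<open>m \<Delta>u\<close>; by antisymmetry the columns
  contribute the same amount, hence the factor \<open>2\<close>.\<close>

lemma Green_formula:
  assumes u: "u \<in> Fp b p" and A: "finite A" "\<And>x. x \<notin> A \<Longrightarrow> F x = 0"
  shows "((\<lambda>(x, y). b x y * (signed_power (u x - u y) (p - 1) * (F x - F y)))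
    has_sum 2 * (\<Sum>x\<in>A. F x * m x * p_laplacian b m p u x)) UNIV"
proof -
  define k where "k x y = F x * (b x y * signed_power (u x - u y) (p - 1))" for x y
  have "(\<lambda>y. b x y * signed_power (u x - u y) (p - 1)) summable_on UNIV" for x
  proof -
    have "(\<lambda>y. norm (b x y * signed_power (u x - u y) (p - 1))) summable_on UNIV"
    proof (rule summable_on_comparison_test)
      show "(\<lambda>y. b x y * \<bar>u x - u y\<bar> powr (p - 1)) summable_on UNIV"
        using u by (simp add: Fp_def)
    qed (use b_nonneg in \<open>auto simp: signed_power_def abs_mult sgn_if\<close>)
    then show ?thesis using summable_on_iff_abs_summable_on_real by blast
  qed
  then have rows: "k x summable_on UNIV" for x
    unfolding k_def by (rule summable_on_cmult_right)
  have zero: "k x y = 0" if "x \<notin> A" for x y using that A by (simp add: k_def)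
  have "((\<lambda>(x, y). k x y + k y x) has_sum 2 * (\<Sum>x\<in>A. \<Sum>\<^sub>\<infinity>y. k x y)) UNIV"
    using has_sum_add[OF has_sum_finite_rows[where k = k, OF A(1) rows zero]
        has_sum_finite_columns[where k = k, OF A(1) rows zero]]
    by (simp add: case_prod_unfold)
  moreover have "k x y + k y x = b x y * (signed_power (u x - u y) (p - 1) * (F x - F y))" for x y
  proof -
    have "signed_power (u y - u x) (p - 1) = - signed_power (u x - u y) (p - 1)"
      by (simp add: signed_power_def abs_minus_commute sgn_if)
    then show ?thesis using b_sym[of x y] by (simp add: k_def algebra_simps)
  qed
  moreover have "(\<Sum>\<^sub>\<infinity>y. k x y) = F x * m x * p_laplacian b m p u x" for x
    using m_pos[of x] by (simp add: k_def p_laplacian_def infsum_cmult_right')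
  ultimately show ?thesis by simp
qed

end

section \<open>The ground state representation\<close>

locale positive_solution = weighted_graph b m
  for b :: "'a::countable \<Rightarrow> 'a \<Rightarrow> real" and m :: "'a \<Rightarrow> real" +
  fixes p :: real and w u :: "'a \<Rightarrow> real"
  assumes p_gt_1: "p > 1"
    and u_Fp: "u \<in> Fp b p"
    and u_pos: "u x > 0"
    and u_solution: "p_laplacian b m p u x = w x * u x powr (p - 1)"
begin

definition deficit :: "('a \<Rightarrow> real) \<Rightarrow> real" where
  "deficit \<phi> = p_energy b p \<phi> - p_form m p w \<phi>"

text \<open>Green's formula with the test function \<open>|\<phi>|\<^sup>p / u\<^sup>p\<^sup>-\<^sup>1\<close> turns the weight form into a sum over
  edges.\<close>

lemma Picone_identity:
  assumes "\<phi> \<in> Cc UNIV"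
  shows "((\<lambda>(x, y). b x y * picone_gap p (u x) (u y) (\<phi> x) (\<phi> y))
    has_sum 2 * deficit \<phi>) UNIV"
proof -
  define A where "A = {x. \<phi> x \<noteq> 0}"
  define F where "F x = \<bar>\<phi> x\<bar> powr p / u x powr (p - 1)" for x
  have fin: "finite A" using finite_support[OF assms] by (simp add: A_def)
  have zero: "F x = 0" if "x \<notin> A" for x using that by (simp add: F_def A_def)
  have "(\<Sum>x\<in>A. F x * m x * p_laplacian b m p u x) = p_form m p w \<phi>"
    using fin u_pos by (subst p_form_eq_sum[of A])
      (auto simp: A_def F_def u_solution field_simps less_imp_neq[symmetric] intro!: sum.cong)
  then have "((\<lambda>(x, y). b x y * (signed_power (u x - u y) (p - 1) * (F x - F y)))
      has_sum 2 * p_form m p w \<phi>) UNIV"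
    using Green_formula[where F = F, OF u_Fp fin zero] by simp
  from has_sum_add[OF energy_has_sum[OF assms, of p] has_sum_uminusI[OF this]] p_gt_1
  have "((\<lambda>(x, y). b x y * \<bar>\<phi> x - \<phi> y\<bar> powr p
      + - (b x y * (signed_power (u x - u y) (p - 1) * (F x - F y)))) has_sum 2 * deficit \<phi>) UNIV"
    by (simp add: deficit_def case_prod_unfold)
  moreover have "b x y * \<bar>\<phi> x - \<phi> y\<bar> powr p
      + - (b x y * (signed_power (u x - u y) (p - 1) * (F x - F y)))
      = b x y * picone_gap p (u x) (u y) (\<phi> x) (\<phi> y)" for x y
    by (simp add: picone_gap_def F_def algebra_simps)
  ultimately show ?thesis by simp
qed

lemma gap_nonneg: "b x y * picone_gap p (u x) (u y) A C \<ge> 0"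
  using b_nonneg picone_gap_nonneg p_gt_1 u_pos by simp

lemma edge_gap_le_deficit:
  assumes "\<phi> \<in> Cc UNIV"
  shows "b x y * picone_gap p (u x) (u y) (\<phi> x) (\<phi> y) \<le> 2 * deficit \<phi>"
  using finite_sum_le_has_sum[OF Picone_identity[OF assms], of "{(x, y)}"] gap_nonneg by auto

lemma deficit_nonneg:
  assumes "\<phi> \<in> Cc UNIV"
  shows "deficit \<phi> \<ge> 0"
  using has_sum_nonneg[OF Picone_identity[OF assms]] gap_nonneg by auto

lemma truncate_Cc:
  assumes "\<phi> \<in> Cc A"
  shows "(\<lambda>x. min \<bar>\<phi> x\<bar> (u x)) \<in> Cc A"
proof -
  have "min \<bar>\<phi> x\<bar> (u x) = 0 \<longleftrightarrow> \<phi> x = 0" for x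
    using u_pos[of x] by (auto simp: min_def)
  then show ?thesis using assms by (simp only: Cc_def mem_Collect_eq) blast
qed

lemma deficit_truncate:
  assumes "\<phi> \<in> Cc UNIV"
  shows "deficit (\<lambda>x. min \<bar>\<phi> x\<bar> (u x)) \<le> deficit \<phi>"
proof -
  have "2 * deficit (\<lambda>x. min \<bar>\<phi> x\<bar> (u x)) \<le> 2 * deficit \<phi>"
    using p_gt_1 u_pos b_nonneg
    by (intro has_sum_mono[OF Picone_identity[OF truncate_Cc[OF assms]] Picone_identity[OF assms]])
       (auto intro!: mult_left_mono picone_gap_truncate)
  then show ?thesis by simp
qed

section \<open>The null sequence of a critical weight\<close>

text \<open>The weight raised by \<open>c\<close> at \<open>z\<close> is not a Hardy-type weight, so some \<open>\<phi>\<close> has deficit below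
  \<open>c |\<phi>(z)|\<^sup>p m(z)\<close>. Deficits are nonnegative, so \<open>\<phi>(z) \<noteq> 0\<close> and \<open>\<phi>\<close> can be rescaled to
  \<open>|\<phi>(z)| = u(z)\<close> and then truncated at \<open>u\<close>, which leaves the value \<open>u(z)\<close> at \<open>z\<close>.\<close>

lemma small_deficit_test_function:
  assumes crit: "p_critical b m p w" and "e > 0"
  obtains \<phi> where "\<phi> \<in> Cc UNIV" "\<And>x. 0 \<le> \<phi> x" "\<And>x. \<phi> x \<le> u x" "\<phi> z = u z" "deficit \<phi> < e"
proof -
  \<comment> \<open>The size of the perturbation is chosen so that the bound after rescaling is exactly \<open>e\<close>.\<close>
  define c where "c = e / (u z powr p * m z)"
  have c: "c > 0" using assms(2) u_pos[of z] m_pos[of z] by (simp add: c_def)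
  define w' where "w' = w(z := w z + c)"
  have "w' z > w z" "\<And>x. w' x \<ge> w x" using c by (auto simp: w'_def)
  then have "\<not> hardy_type_weight b m p w'"
    using crit unfolding p_critical_def by (metis less_irrefl)
  then obtain \<phi> where \<phi>: "\<phi> \<in> Cc UNIV" "p_energy b p \<phi> < p_form m p w' \<phi>"
    by (auto simp: hardy_type_weight_def not_le)
  have form: "p_form m p w' \<phi> = p_form m p w \<phi> + c * \<bar>\<phi> z\<bar> powr p * m z"
  proof -
    define A where "A = insert z {x. \<phi> x \<noteq> 0}"
    have A: "finite A" "{x. \<phi> x \<noteq> 0} \<subseteq> A" "z \<in> A"
      using finite_support[OF \<phi>(1)] by (auto simp: A_def)
    have "p_form m p w' \<phi> = (\<Sum>x\<in>A. w x * \<bar>\<phi> x\<bar> powr p * m x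
        + (if x = z then c * \<bar>\<phi> z\<bar> powr p * m z else 0))"
      unfolding p_form_eq_sum[OF A(1,2)]
      by (intro sum.cong) (auto simp: w'_def algebra_simps)
    then show ?thesis using A by (simp add: p_form_eq_sum[OF A(1,2)] sum.distrib)
  qed
  then have less: "deficit \<phi> < c * \<bar>\<phi> z\<bar> powr p * m z" using \<phi>(2) by (simp add: deficit_def)
  have z: "\<phi> z \<noteq> 0" using less deficit_nonneg[OF \<phi>(1)] by auto
  define s where "s = u z / \<bar>\<phi> z\<bar>"
  have s: "s > 0" using z u_pos by (simp add: s_def)
  define \<psi> where "\<psi> = (\<lambda>x. s * \<phi> x)"
  have \<psi>: "\<psi> \<in> Cc UNIV" using \<phi>(1) s by (simp add: \<psi>_def Cc_def)
  have "deficit \<psi> = s powr p * deficit \<phi>"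
    using s by (simp add: deficit_def \<psi>_def p_energy_scale p_form_scale algebra_simps)
  also have "\<dots> < s powr p * (c * \<bar>\<phi> z\<bar> powr p * m z)"
    using less s by simp
  also have "\<dots> = c * (s * \<bar>\<phi> z\<bar>) powr p * m z"
    using s by (simp add: powr_mult)
  also have "\<dots> = e"
    using z u_pos[of z] m_pos[of z] by (simp add: s_def c_def)
  finally have "deficit \<psi> < e" .
  then have "deficit (\<lambda>x. min \<bar>\<psi> x\<bar> (u x)) < e" using deficit_truncate[OF \<psi>] by simp
  moreover have "min \<bar>\<psi> z\<bar> (u z) = u z" using s z by (simp add: \<psi>_def abs_mult s_def)
  ultimately show ?thesis
    using that[OF truncate_Cc[OF \<psi>]] u_pos by (simp add: less_imp_le)
qed

text \<open>The test functions agree with \<open>u\<close> at \<open>z\<close>, and stability of the gap passes convergence from each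
  vertex to its neighbours; connectedness does the rest.\<close>

lemma null_sequence:
  assumes crit: "p_critical b m p w"
  obtains \<phi> where "\<And>n. \<phi> n \<in> Cc UNIV" "\<And>n x. 0 \<le> \<phi> n x" "\<And>n x. \<phi> n x \<le> u x"
    "\<And>n. deficit (\<phi> n) \<le> 1" "\<And>x. (\<lambda>n::nat. \<phi> n x) \<longlonglongrightarrow> u x"
proof -
  fix z :: 'a
  have "\<forall>n::nat. \<exists>\<phi>. \<phi> \<in> Cc UNIV \<and> (\<forall>x. 0 \<le> \<phi> x) \<and> (\<forall>x. \<phi> x \<le> u x) \<and> \<phi> z = u z
      \<and> deficit \<phi> < 1 / real (Suc n)"
    using small_deficit_test_function[OF crit] by (metis of_nat_0_less_iff zero_less_Suc zero_less_divide_1_iff)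
  then obtain \<phi> where \<phi>: "\<And>n. \<phi> n \<in> Cc UNIV" "\<And>n x. 0 \<le> \<phi> n x" "\<And>n x. \<phi> n x \<le> u x"
    "\<And>n::nat. \<phi> n z = u z" "\<And>n. deficit (\<phi> n) < 1 / real (Suc n)" by metis
  have lim0: "(\<lambda>n. deficit (\<phi> n)) \<longlonglongrightarrow> 0"
    by (rule tendsto_sandwich[OF _ _ tendsto_const LIMSEQ_Suc[OF lim_1_over_n]])
       (use deficit_nonneg \<phi> in \<open>auto intro!: always_eventually less_imp_le\<close>)
  have "(\<lambda>n. \<phi> n x) \<longlonglongrightarrow> u x" for x
    using b_connected[of z x]
  proof (induction rule: rtrancl_induct)
    case base
    then show ?case by (simp add: \<phi>)
  next
    case (step x y)
    then have b: "b x y > 0" by simp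
    have "(\<lambda>n. picone_gap p (u x) (u y) (\<phi> n x) (\<phi> n y)) \<longlonglongrightarrow> 0"
    proof (rule tendsto_sandwich[OF _ _ tendsto_const])
      show "(\<lambda>n. 2 * deficit (\<phi> n) / b x y) \<longlonglongrightarrow> 0"
        using tendsto_divide[OF tendsto_mult[OF tendsto_const[of 2] lim0] tendsto_const[of "b x y"]] b
        by simp
      show "\<forall>\<^sub>F n in sequentially. picone_gap p (u x) (u y) (\<phi> n x) (\<phi> n y) \<le> 2 * deficit (\<phi> n) / b x y"
        using edge_gap_le_deficit[OF \<phi>(1)] b by (simp add: field_simps)
    qed (use picone_gap_nonneg p_gt_1 u_pos in auto)
    then show ?case by (rule picone_gap_stability[OF p_gt_1 u_pos u_pos step.IH \<phi>(2,3)])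
  qed
  moreover have "deficit (\<phi> n) \<le> 1" for n
    using less_le_trans[OF \<phi>(5), of n 1] by (simp add: less_imp_le)
  ultimately show ?thesis using that \<phi> by blast
qed

section \<open>Cutting off on a finite set\<close>

text \<open>An edge from \<open>x \<in> K\<close> to \<open>y \<notin> K\<close> has energy \<open>\<phi>(y)\<^sup>p\<close> after the cut-off. By the tangent inequality
  this exceeds the energy before by at most \<open>p \<phi>(x) \<phi>(y)\<^sup>p\<^sup>-\<^sup>1 \<le> p u(x) u(y)\<^sup>p\<^sup>-\<^sup>1\<close>, which is summable in
  \<open>y\<close> because \<open>u \<in> F\<^sub>p\<close>. The weight form loses at most the finite sum of \<open>w u\<^sup>p m\<close> over \<open>K\<close>.\<close>

lemma deficit_cutoff_bound:
  assumes K: "finite K" and w: "\<And>x. w x \<ge> 0"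
  obtains C where "\<And>\<phi>. \<lbrakk>\<phi> \<in> Cc UNIV; \<And>x. 0 \<le> \<phi> x; \<And>x. \<phi> x \<le> u x\<rbrakk>
      \<Longrightarrow> deficit (\<lambda>x. if x \<in> K then 0 else \<phi> x) \<le> deficit \<phi> + C"
proof
  define k where "k x y = (if x \<in> K then p * u x * (b x y * u y powr (p - 1)) else 0)" for x y
  have rows: "k x summable_on UNIV" if "x \<in> K" for x
    unfolding k_def using that Fp_summable_powr[OF u_Fp p_gt_1 u_pos]
    by (simp add: summable_on_cmult_right)
  have zero: "k x y = 0" if "x \<notin> K" for x y using that by (simp add: k_def)
  have k_nonneg: "k x y \<ge> 0" for x y
    using p_gt_1 u_pos b_nonneg by (auto simp: k_def less_imp_le)
  define D where "D = (\<Sum>x\<in>K. \<Sum>\<^sub>\<infinity>y. k x y)"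
  have D: "((\<lambda>(x, y). k x y + k y x) has_sum 2 * D) UNIV"
    using has_sum_add[OF has_sum_finite_rows[where k = k, OF K rows zero] has_sum_finite_columns[where k = k, OF K rows zero]]
    by (simp add: case_prod_unfold D_def)
  fix \<phi> assume \<phi>: "\<phi> \<in> Cc UNIV" "\<And>x. 0 \<le> \<phi> x" "\<And>x. \<phi> x \<le> u x"
  define \<psi> where "\<psi> x = (if x \<in> K then 0 else \<phi> x)" for x
  have \<psi>: "\<psi> \<in> Cc UNIV"
    unfolding \<psi>_def using cutoff_Cc[OF \<phi>(1)] Cc_mono[OF subset_UNIV] by blast
  have cut: "\<phi> y powr p \<le> \<bar>\<phi> x - \<phi> y\<bar> powr p + p * u x * u y powr (p - 1)" for x y
  proof -
    have "\<phi> y powr p - p * \<phi> y powr (p - 1) * \<phi> x \<le> \<bar>\<phi> x - \<phi> y\<bar> powr p"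
      using abs_powr_ge_tangent[OF p_gt_1, of "\<phi> y" "\<phi> y - \<phi> x"] \<phi>(2)[of y]
      by (cases "\<phi> y = 0") (auto simp: signed_power_def abs_minus_commute)
    moreover have "\<phi> y powr (p - 1) * \<phi> x \<le> u y powr (p - 1) * u x"
      using \<phi> p_gt_1 by (intro mult_mono powr_mono2) auto
    then have "p * (\<phi> y powr (p - 1) * \<phi> x) \<le> p * (u y powr (p - 1) * u x)"
      using p_gt_1 by (intro mult_left_mono) auto
    ultimately show ?thesis by (simp add: mult_ac)
  qed
  have pointwise: "b x y * \<bar>\<psi> x - \<psi> y\<bar> powr p \<le> b x y * \<bar>\<phi> x - \<phi> y\<bar> powr p + (k x y + k y x)" for x y
  proof (cases "x \<in> K"; cases "y \<in> K")
    assume "x \<in> K" "y \<in> K"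
    then show ?thesis using b_nonneg k_nonneg by (simp add: \<psi>_def)
  next
    assume "x \<in> K" "y \<notin> K"
    then show ?thesis using mult_left_mono[OF cut b_nonneg, of x y y x] \<phi>(2)[of y]
      by (simp add: \<psi>_def k_def algebra_simps)
  next
    assume "x \<notin> K" "y \<in> K"
    then show ?thesis using mult_left_mono[OF cut b_nonneg, of x y x y] \<phi>(2)[of x] b_sym[of x y]
      by (simp add: \<psi>_def k_def algebra_simps abs_minus_commute)
  qed (simp add: \<psi>_def k_def)
  have "2 * p_energy b p \<psi> \<le> 2 * p_energy b p \<phi> + 2 * D"
    using p_gt_1 pointwise
    by (intro has_sum_mono[OF energy_has_sum[OF \<psi>] has_sum_add[OF energy_has_sum[OF \<phi>(1)] D]]) auto
  moreover have "p_form m p w \<phi> \<le> p_form m p w \<psi> + (\<Sum>x\<in>K. w x * u x powr p * m x)"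
  proof -
    define A where "A = K \<union> {x. \<phi> x \<noteq> 0}"
    have A: "finite A" "{x. \<phi> x \<noteq> 0} \<subseteq> A" "{x. \<psi> x \<noteq> 0} \<subseteq> A"
      using K finite_support[OF \<phi>(1)] by (auto simp: A_def \<psi>_def)
    have "p_form m p w \<phi> = (\<Sum>x\<in>A. w x * \<bar>\<psi> x\<bar> powr p * m x
        + (if x \<in> K then w x * \<bar>\<phi> x\<bar> powr p * m x else 0))"
      unfolding p_form_eq_sum[OF A(1,2)] using p_gt_1 by (intro sum.cong) (auto simp: \<psi>_def)
    also have "\<dots> = p_form m p w \<psi> + (\<Sum>x\<in>K. w x * \<bar>\<phi> x\<bar> powr p * m x)"
      using A(1) by (simp add: sum.distrib p_form_eq_sum[OF A(1,3)] sum.If_cases A_def Int_absorb1)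
    also have "\<dots> \<le> p_form m p w \<psi> + (\<Sum>x\<in>K. w x * u x powr p * m x)"
      using \<phi> p_gt_1 w m_pos
      by (intro add_left_mono sum_mono mult_right_mono mult_left_mono powr_mono2)
         (auto simp: less_imp_le)
    finally show ?thesis .
  qed
  ultimately show "deficit (\<lambda>x. if x \<in> K then 0 else \<phi> x)
      \<le> deficit \<phi> + (D + (\<Sum>x\<in>K. w x * u x powr p * m x))"
    unfolding \<psi>_def[symmetric] deficit_def by (simp add: \<psi>_def)
qed

lemma ground_state_in_lp:
  assumes crit: "p_critical b m p w" and w: "\<And>x. w x \<ge> 0"
    and K: "finite K" and w': "\<And>x. w' x \<ge> 0"
    and hardy: "\<And>\<phi>. \<phi> \<in> Cc (- K) \<Longrightarrow> p_energy b p \<phi> \<ge> p_form m p (\<lambda>x. w x + w' x) \<phi>"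
  shows "u \<in> lp_space p (\<lambda>x. w' x * m x)"
proof -
  obtain \<phi> where \<phi>: "\<And>n. \<phi> n \<in> Cc UNIV" "\<And>n x. 0 \<le> \<phi> n x" "\<And>n x. \<phi> n x \<le> u x"
    "\<And>n. deficit (\<phi> n) \<le> 1" "\<And>x. (\<lambda>n::nat. \<phi> n x) \<longlonglongrightarrow> u x"
    using null_sequence[OF crit] by blast
  obtain C where C: "\<And>\<phi>. \<lbrakk>\<phi> \<in> Cc UNIV; \<And>x. 0 \<le> \<phi> x; \<And>x. \<phi> x \<le> u x\<rbrakk>
      \<Longrightarrow> deficit (\<lambda>x. if x \<in> K then 0 else \<phi> x) \<le> deficit \<phi> + C"
    using deficit_cutoff_bound[OF K w] by blast
  define g where "g x = \<bar>u x\<bar> powr p * (w' x * m x)" for x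
  have g_nonneg: "g x \<ge> 0" for x using w' m_pos by (simp add: g_def less_imp_le)
  have off_K: "sum g F \<le> 1 + C" if F: "finite F" "F \<inter> K = {}" for F
  proof (rule LIMSEQ_le_const2)
    show "(\<lambda>n. \<Sum>x\<in>F. \<bar>\<phi> n x\<bar> powr p * (w' x * m x)) \<longlonglongrightarrow> sum g F"
      unfolding g_def using p_gt_1 u_pos
      by (intro tendsto_intros \<phi>(5)) (auto simp: less_imp_neq[symmetric])
    have "(\<Sum>x\<in>F. \<bar>\<phi> n x\<bar> powr p * (w' x * m x)) \<le> 1 + C" for n
    proof -
      define \<psi> where "\<psi> x = (if x \<in> K then 0 else \<phi> n x)" for x
      define A where "A = F \<union> {x. \<phi> n x \<noteq> 0}"
      have A: "finite A" "F \<subseteq> A" "{x. \<psi> x \<noteq> 0} \<subseteq> A"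
        using finite_support[OF \<phi>(1)] F by (auto simp: A_def \<psi>_def)
      have \<psi>: "\<psi> \<in> Cc (- K)"
        unfolding \<psi>_def by (rule cutoff_Cc[OF \<phi>(1)])
      have "(\<Sum>x\<in>F. \<bar>\<phi> n x\<bar> powr p * (w' x * m x)) = (\<Sum>x\<in>F. w' x * \<bar>\<psi> x\<bar> powr p * m x)"
        using F by (intro sum.cong) (auto simp: \<psi>_def)
      also have "\<dots> \<le> p_form m p w' \<psi>"
        unfolding p_form_eq_sum[OF A(1,3)] using A w' m_pos
        by (intro sum_mono2) (auto simp: less_imp_le)
      also have "\<dots> = p_form m p (\<lambda>x. w x + w' x) \<psi> - p_form m p w \<psi>"
        by (simp add: p_form_eq_sum[OF A(1,3)] algebra_simps sum.distrib)
      also have "\<dots> \<le> deficit \<psi>" using hardy[OF \<psi>] by (simp add: deficit_def)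
      also have "\<dots> \<le> 1 + C"
        using C[OF \<phi>(1-3), of n] \<phi>(4)[of n] unfolding \<psi>_def by linarith
      finally show ?thesis .
    qed
    then show "\<exists>N. \<forall>n\<ge>N. (\<Sum>x\<in>F. \<bar>\<phi> n x\<bar> powr p * (w' x * m x)) \<le> 1 + C" by blast
  qed
  have "sum g F \<le> sum g K + (1 + C)" if "finite F" for F
  proof -
    have "sum g F = sum g (F \<inter> K) + sum g (F - K)" using that by (rule sum.Int_Diff)
    also have "\<dots> \<le> sum g K + (1 + C)"
      using that K g_nonneg by (intro add_mono sum_mono2 off_K) auto
    finally show ?thesis .
  qed
  then have "g summable_on UNIV"
    using g_nonneg by (intro nonneg_bdd_above_summable_on) (auto intro!: bdd_aboveI2)
  then show ?thesis by (simp add: lp_space_def g_def[abs_def])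
qed

end

section \<open>Decay of perturbations and optimality at infinity\<close>

theorem theoremA1:
  fixes b :: "'a::countable \<Rightarrow> 'a \<Rightarrow> real" and m :: "'a \<Rightarrow> real"
    and p :: real and u w :: "'a \<Rightarrow> real"
  assumes "weighted_graph b m"
    and "p > 1"
    and "\<And>x. w x = p_laplacian b m p u x / u x powr (p - 1)"
    and "hardy_weight b m p w"
    and "p_critical b m p w"
    and "agmon_ground_state b m p w u"
  shows "(\<forall>(K :: 'a set) (w' :: 'a \<Rightarrow> real).
            finite K \<longrightarrow> (\<forall>x. w' x \<ge> 0) \<longrightarrow>
            (\<forall>\<phi>\<in>Cc (- K). p_energy b p \<phi> \<ge> p_form m p (\<lambda>x. w x + w' x) \<phi>) \<longrightarrow>
            u \<in> lp_space p (\<lambda>x. w' x * m x))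
       \<and> (p_null_critical b m p w \<longrightarrow> p_optimal_at_infinity b m p w)"
proof -
  have u: "u \<in> Fp b p" "\<And>x. u x > 0"
    using assms(6) by (auto simp: agmon_ground_state_def positive_supersolution_def)
  have w_pos: "\<And>x. w x > 0" using assms(4) by (simp add: hardy_weight_def)
  interpret positive_solution b m p w u
    using assms(1) unfolding positive_solution_def positive_solution_axioms_def
    using assms(2,3) u by (simp add: less_imp_neq[symmetric])
  have first: "u \<in> lp_space p (\<lambda>x. w' x * m x)"
    if "finite K" "\<And>x. w' x \<ge> 0"
      "\<And>\<phi>. \<phi> \<in> Cc (- K) \<Longrightarrow> p_energy b p \<phi> \<ge> p_form m p (\<lambda>x. w x + w' x) \<phi>" for K w'
    using ground_state_in_lp[OF assms(5) less_imp_le[OF w_pos] that] .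
  have "l \<le> 0" if null: "p_null_critical b m p w" and K: "finite K"
    and l: "\<forall>\<phi>\<in>Cc (- K). p_energy b p \<phi> \<ge> (1 + l) * p_form m p w \<phi>" for l K
  proof (rule ccontr)
    assume "\<not> l \<le> 0"
    then have "l > 0" by simp
    have "p_form m p (\<lambda>x. w x + l * w x) \<phi> = (1 + l) * p_form m p w \<phi>" for \<phi>
      unfolding p_form_def by (simp add: algebra_simps flip: infsum_cmult_right')
    then have "u \<in> lp_space p (\<lambda>x. l * w x * m x)"
      using first[OF K, of "\<lambda>x. l * w x"] l \<open>l > 0\<close> w_pos by (simp add: less_imp_le)
    then have "(\<lambda>x. (1 / l) * (\<bar>u x\<bar> powr p * (l * w x * m x))) summable_on UNIV"
      unfolding lp_space_def mem_Collect_eq by (rule summable_on_cmult_right)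
    then have u_lp: "(\<lambda>x. \<bar>u x\<bar> powr p * (w x * m x)) summable_on UNIV"
      using \<open>l > 0\<close> by (simp add: mult_ac)
    obtain v where v: "agmon_ground_state b m p w v" "v \<notin> lp_space p (\<lambda>x. \<bar>w x\<bar> * m x)"
      using null by (auto simp: p_null_critical_def)
    then obtain c where "c > 0" "\<And>x. v x = c * u x"
      using assms(6) unfolding agmon_ground_state_def by metis
    then have "(\<lambda>x. \<bar>v x\<bar> powr p * (\<bar>w x\<bar> * m x)) = (\<lambda>x. c powr p * (\<bar>u x\<bar> powr p * (w x * m x)))"
      using w_pos by (auto simp: abs_mult powr_mult abs_of_pos)
    then have "v \<in> lp_space p (\<lambda>x. \<bar>w x\<bar> * m x)"
      using summable_on_cmult_right[OF u_lp] by (simp add: lp_space_def)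
    then show False using v by simp
  qed
  then show ?thesis using first assms(4) by (auto simp: p_optimal_at_infinity_def)
qed

end
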